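(* Let $K$ be a field, let $A=\{\mathbf a_1,\dots,\mathbf a_n\}\subset\mathbb Z_{\ge 0}^d$ be a configuration, let $K[A]$ be its semigroup ring, and let $K[\Lambda(A)]$ be the semigroup ring of the Lawrence lifting $\Lambda(A)$ of $A$. Then the following conditions are equivalent: (i) $K[A]$ is unimodular; (ii) $K[\Lambda(A)]$ is unimodular; (iii) $K[\Lambda(A)]$ is very ample.
   Context: A configuration in $\mathbb R^d$ is a finite set $A=\{\mathbf a_1,\dots,\mathbf a_n\}\subset\mathbb Z_{\ge 0}^d$ (with $\mathbf a_1,\dots,\mathbf a_n$ distinct) such that there exists $\mathbf w\in\mathbb R^d$ with $\mathbf w\cdot\mathbf a_i=1$ for all $i$. We also write $A$ for the $d\times n$ matrix with columns $\mathbf a_1,\dots,\mathbf a_n$. For a field $K$, write $\mathbf t^{\mathbf a}=t_1^{a_1}\cdots t_d^{a_d}$ for $\mathbf a=(a_1,\dots,a_d)$. The semigroup ring of $A$ is $K[A]=K[\mathbf t^{\mathbf a_1},\dots,\mathbf t^{\mathbf a_n}]\subset K[t_1,\dots,t_d]$. The toric ideal $I_A$ is the kernel of the surjective $K$-algebra homomorphism $\pi:K[x_1,\dots,x_n]\to K[A]$, $\pi(x_i)=\mathbf t^{\mathbf a_i}$. $A$ (or $K[A]$) is unimodular if the initial ideal of $I_A$ is generated by squarefree monomials with respect to any monomial order. $\mathbb Z_{\ge 0}A$, $\mathbb ZA$, $\mathbb Q_{\ge 0}A$ denote the sets of linear combinations of elements of $A$ with coefficients in $\mathbb Z_{\ge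 0}$, $\mathbb Z$, $\mathbb Q_{\ge 0}$ respectively. $K[A]$ is very ample if $(\mathbb ZA\cap\mathbb Q_{\ge 0}A)\setminus\mathbb Z_{\ge 0}A$ is a finite (or empty) set. The Lawrence lifting $\Lambda(A)$ of $A$ is the configuration in $\mathbb R^{d+n}$ consisting of the $2n$ columns of the matrix $$\Lambda(A)=\begin{pmatrix}A&\mathbf 0\\ I_n&I_n\end{pmatrix},$$ where $I_n$ is the $n\times n$ identity matrix and $\mathbf 0$ is the $d\times n$ zero matrix. The notions above are applied to $\Lambda(A)$ in the same way. *)

theory Defs
  imports "HOL-Analysis.Analysis" "HOL-Library.Poly_Mapping"
begin

section \<open>Polynomials and ideals\<close>

text \<open>
  The ring of polynomials over a field \<open>'k\<close> in variables indexed by a finite type \<open>'v\<close> is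
  \<open>('v \<Rightarrow>\<^sub>0 nat) \<Rightarrow>\<^sub>0 'k\<close>: an element of \<open>'v \<Rightarrow>\<^sub>0 nat\<close> is an exponent vector, and multiplication
  is convolution.
\<close>

type_synonym ('v, 'k) mpoly = "('v \<Rightarrow>\<^sub>0 nat) \<Rightarrow>\<^sub>0 'k"

definition scalar :: "'k::zero \<Rightarrow> ('v, 'k) mpoly" where
  "scalar c = Poly_Mapping.single 0 c"

definition var :: "'v \<Rightarrow> ('v, 'k::zero_neq_one) mpoly" where
  "var i = Poly_Mapping.single (Poly_Mapping.single i 1) 1"

global_interpretation ideal: module "(*) :: 'a::comm_ring_1 \<Rightarrow> 'a \<Rightarrow> 'a"
  defines ideal = ideal.span
  by standard (simp_all add: algebra_simps)


section \<open>Configurations and toric ideals\<close>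

text \<open>
  A configuration is given by its matrix, with rows indexed by \<open>'d\<close> (the ambient dimension is
  \<open>CARD('d)\<close>) and columns indexed by \<open>'n\<close>.
\<close>

definition configuration :: "nat ^ 'n ^ 'd \<Rightarrow> bool" where
  "configuration A \<longleftrightarrow>
     inj (\<lambda>j. column j A) \<and>
     (\<exists>w :: real ^ 'd. \<forall>j. w \<bullet> (\<chi> i. real (A $ i $ j)) = 1)"

definition monomial :: "nat ^ 'd \<Rightarrow> ('d, 'k::field) mpoly" where
  "monomial a = (\<Prod>i\<in>UNIV. var i ^ (a $ i))"

inductive_set semigroup_ring :: "nat ^ 'n ^ 'd \<Rightarrow> ('d, 'k::field) mpoly set"
  for A :: "nat ^ 'n ^ 'd" where
  "scalar c \<in> semigroup_ring A"
| "monomial (column j A) \<in> semigroup_ring A"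
| "p \<in> semigroup_ring A \<Longrightarrow> q \<in> semigroup_ring A \<Longrightarrow> p + q \<in> semigroup_ring A"
| "p \<in> semigroup_ring A \<Longrightarrow> q \<in> semigroup_ring A \<Longrightarrow> p * q \<in> semigroup_ring A"

text \<open>
  The \<open>'k\<close>-algebra homomorphism sending \<open>x\<^sub>j\<close> to \<open>t\<^sup>a\<close> with \<open>a\<close> the \<open>j\<close>-th column. It is shown
  below to be a homomorphism with image \<open>semigroup_ring A\<close>.
\<close>

definition toric_hom :: "nat ^ 'n ^ 'd \<Rightarrow> ('n, 'k::field) mpoly \<Rightarrow> ('d, 'k) mpoly" where
  "toric_hom A f =
     (\<Sum>u\<in>Poly_Mapping.keys f. scalar (Poly_Mapping.lookup f u) *
        (\<Prod>j\<in>UNIV. monomial (column j A) ^ Poly_Mapping.lookup u j))"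

definition toric_ideal :: "nat ^ 'n ^ 'd \<Rightarrow> ('n, 'k::field) mpoly set" where
  "toric_ideal A = {f. toric_hom A f = 0}"

lemma scalar_0 [simp]: "scalar 0 = 0"
  and scalar_1 [simp]: "scalar 1 = 1"
  and scalar_add: "scalar (a + b) = scalar a + scalar b"
  by (simp_all add: scalar_def single_add)

lemma scalar_mult: "scalar (a * b) = (scalar a * scalar b :: ('v, 'k::field) mpoly)"
  by (simp add: scalar_def mult_single)

lemma toric_hom_superset:
  assumes "finite S" "Poly_Mapping.keys f \<subseteq> S"
  shows "toric_hom A f =
     (\<Sum>u\<in>S. scalar (Poly_Mapping.lookup f u) * (\<Prod>j\<in>UNIV. monomial (column j A) ^ Poly_Mapping.lookup u j))"
  unfolding toric_hom_def
  by (rule sum.mono_neutral_left) (use assms in \<open>auto simp: in_keys_iff\<close>)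

lemma toric_hom_single:
  "toric_hom A (Poly_Mapping.single u c) =
     scalar c * (\<Prod>j\<in>UNIV. monomial (column j A) ^ Poly_Mapping.lookup u j)"
  by (subst toric_hom_superset[of "{u}"]) auto

lemma toric_hom_scalar: "toric_hom A (scalar c) = scalar c"
  by (subst scalar_def) (simp add: toric_hom_single)

lemma toric_hom_var:
  fixes A :: "nat ^ 'n ^ 'd"
  shows "toric_hom A (var j) = (monomial (column j A) :: ('d, 'k::field) mpoly)"
proof -
  have "(\<Prod>i\<in>UNIV. monomial (column i A) ^ Poly_Mapping.lookup (Poly_Mapping.single j 1) i) =
        (\<Prod>i\<in>UNIV. if i = j then monomial (column i A) else (1 :: ('d, 'k) mpoly))"
    by (rule prod.cong) (auto simp: Poly_Mapping.lookup_single when_def)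
  then show ?thesis by (simp add: var_def toric_hom_single)
qed

lemma toric_hom_add: "toric_hom A (f + g) = toric_hom A f + toric_hom A g"
proof -
  let ?S = "Poly_Mapping.keys f \<union> Poly_Mapping.keys g"
  have "Poly_Mapping.keys (f + g) \<subseteq> ?S" by (rule keys_add)
  then show ?thesis
    by (simp add: toric_hom_superset[of ?S] Poly_Mapping.lookup_add scalar_add distrib_right sum.distrib)
qed

lemma mpoly_induct [case_names single add]:
  fixes f :: "'a \<Rightarrow>\<^sub>0 'b::comm_monoid_add"
  assumes "\<And>u c. P (Poly_Mapping.single u c)" and "\<And>f g. P f \<Longrightarrow> P g \<Longrightarrow> P (f + g)"
  shows "P f"
proof (induction f rule: update_induct)
  case const
  then show ?case using assms(1)[of undefined 0] by simp
next
  case (update f a b)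
  have "Poly_Mapping.update a b f = f + Poly_Mapping.single a b"
    using update by (intro poly_mapping_eqI)
      (auto simp: Poly_Mapping.lookup_update Poly_Mapping.lookup_add Poly_Mapping.lookup_single when_def in_keys_iff)
  then show ?case using assms update by simp
qed

lemma toric_hom_mult: "toric_hom A (f * g) = toric_hom A f * toric_hom A g"
proof (induction f rule: mpoly_induct)
  case (single u c)
  show ?case
  proof (induction g rule: mpoly_induct)
    case (single v d)
    show ?case
      unfolding mult_single toric_hom_single scalar_mult Poly_Mapping.lookup_add power_add
        prod.distrib
      by (simp only: mult_ac)
  next
    case (add g1 g2)
    then show ?case by (simp only: distrib_left toric_hom_add)
  qed
next
  case (add f1 f2)
  then show ?case by (simp only: distrib_right toric_hom_add)
qed

lemma range_toric_hom:
  fixes A :: "nat ^ 'n ^ 'd"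
  shows "range (toric_hom A) = (semigroup_ring A :: ('d, 'k::field) mpoly set)"
proof (intro set_eqI iffI)
  fix p :: "('d, 'k) mpoly"
  assume "p \<in> range (toric_hom A)"
  then obtain f where p: "p = toric_hom A f" by auto
  have one: "1 \<in> (semigroup_ring A :: ('d, 'k) mpoly set)"
    using semigroup_ring.intros(1)[of 1 A] by simp
  have pow: "q ^ k \<in> semigroup_ring A" if "q \<in> semigroup_ring A" for q :: "('d, 'k) mpoly" and k
    using that one by (induction k) (auto intro: semigroup_ring.intros)
  have prod: "prod q J \<in> semigroup_ring A" if "\<And>j. q j \<in> semigroup_ring A"
    for q :: "'n \<Rightarrow> ('d, 'k) mpoly" and J
    using one that by (induction J rule: infinite_finite_induct) (auto intro: semigroup_ring.intros)
  show "p \<in> semigroup_ring A" unfolding p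
  proof (induction f rule: mpoly_induct)
    case (single u c)
    show ?case unfolding toric_hom_single
      by (intro semigroup_ring.intros(4) semigroup_ring.intros(1) prod pow semigroup_ring.intros(2))
  next
    case (add f g)
    then show ?case unfolding toric_hom_add by (rule semigroup_ring.intros(3))
  qed
next
  fix p :: "('d, 'k) mpoly"
  assume "p \<in> semigroup_ring A"
  then show "p \<in> range (toric_hom A)"
  proof induction
    case (1 c)
    show ?case using rangeI[of "toric_hom A" "scalar c"] by (simp only: toric_hom_scalar)
  next
    case (2 j)
    show ?case using rangeI[of "toric_hom A" "var j"] by (simp only: toric_hom_var)
  next
    case (3 p q)
    then obtain f g where "p = toric_hom A f" "q = toric_hom A g" by auto
    then have "p + q = toric_hom A (f + g)" by (simp only: toric_hom_add)
    then show ?case by (simp only: rangeI)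
  next
    case (4 p q)
    then obtain f g where "p = toric_hom A f" "q = toric_hom A g" by auto
    then have "p * q = toric_hom A (f * g)" by (simp only: toric_hom_mult)
    then show ?case by (simp only: rangeI)
  qed
qed


section \<open>Initial ideals and unimodularity\<close>

text \<open>
  A monomial order is a relation on exponent vectors; \<open>(u, v) \<in> r\<close> means that \<open>u\<close> is at most \<open>v\<close>.
\<close>

definition monomial_order :: "('v \<Rightarrow>\<^sub>0 nat) rel \<Rightarrow> bool" where
  "monomial_order r \<longleftrightarrow>
     linear_order r \<and>
     (\<forall>u. (0, u) \<in> r) \<and>
     (\<forall>u v w. (u, v) \<in> r \<longrightarrow> (u + w, v + w) \<in> r)"

text \<open>The exponent of the initial monomial; only meaningful for \<open>f \<noteq> 0\<close>.\<close>

definition lead_exp :: "('v \<Rightarrow>\<^sub>0 nat) rel \<Rightarrow> ('v, 'k::zero) mpoly \<Rightarrow> 'v \<Rightarrow>\<^sub>0 nat" where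
  "lead_exp r f =
     (THE u. u \<in> Poly_Mapping.keys f \<and> (\<forall>v\<in>Poly_Mapping.keys f. (v, u) \<in> r))"

definition initial_ideal ::
    "('v \<Rightarrow>\<^sub>0 nat) rel \<Rightarrow> ('v, 'k::field) mpoly set \<Rightarrow> ('v, 'k) mpoly set" where
  "initial_ideal r I = ideal {Poly_Mapping.single (lead_exp r f) 1 | f. f \<in> I \<and> f \<noteq> 0}"

definition squarefree_exp :: "('v \<Rightarrow>\<^sub>0 nat) \<Rightarrow> bool" where
  "squarefree_exp u \<longleftrightarrow> (\<forall>i. Poly_Mapping.lookup u i \<le> 1)"

definition generated_by_squarefree_monomials :: "('v, 'k::field) mpoly set \<Rightarrow> bool" where
  "generated_by_squarefree_monomials J \<longleftrightarrow>
     (\<exists>S. (\<forall>u\<in>S. squarefree_exp u) \<and> J = ideal ((\<lambda>u. Poly_Mapping.single u 1) ` S))"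

definition unimodular :: "'k::field itself \<Rightarrow> nat ^ 'n ^ 'd \<Rightarrow> bool" where
  "unimodular K A \<longleftrightarrow>
     (\<forall>r. monomial_order r \<longrightarrow>
        generated_by_squarefree_monomials
          (initial_ideal r (toric_ideal A :: ('n, 'k) mpoly set)))"


section \<open>Very ampleness\<close>

text \<open>
  Linear combinations of the columns, in \<open>\<rat>\<^sup>d\<close>; the coefficient sets \<open>\<nat>\<close>, \<open>\<int>\<close> and \<open>{0..}\<close> are
  subsets of \<open>rat\<close>.
\<close>

definition lin_combs :: "rat set \<Rightarrow> nat ^ 'n ^ 'd \<Rightarrow> (rat ^ 'd) set" where
  "lin_combs C A =
     {\<Sum>j\<in>UNIV. c j *s (\<chi> i. of_nat (A $ i $ j)) | c. \<forall>j. c j \<in> C}"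

definition very_ample :: "nat ^ 'n ^ 'd \<Rightarrow> bool" where
  "very_ample A \<longleftrightarrow> finite ((lin_combs \<int> A \<inter> lin_combs {0..} A) - lin_combs \<nat> A)"


section \<open>Lawrence liftings\<close>

definition lawrence :: "nat ^ 'n ^ 'd \<Rightarrow> nat ^ ('n + 'n) ^ ('d + 'n)" where
  "lawrence A = (\<chi> i j. case i of
       Inl r \<Rightarrow> (case j of Inl c \<Rightarrow> A $ r $ c | Inr c \<Rightarrow> 0)
     | Inr r \<Rightarrow> (case j of Inl c \<Rightarrow> mat 1 $ r $ c | Inr c \<Rightarrow> mat 1 $ r $ c))"

lemma configuration_lawrence:
  fixes A :: "nat ^ 'n ^ 'd"
  assumes "configuration A"
  shows "configuration (lawrence A)"
proof -
  obtain w :: "real ^ 'd" where w: "\<And>j. w \<bullet> (\<chi> i. real (A $ i $ j)) = 1"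
    using assms by (auto simp: configuration_def)
  have nz: "\<exists>i. A $ i $ j \<noteq> 0" for j
  proof (rule ccontr)
    assume "\<not> ?thesis"
    then show False using w[of j] by (simp add: inner_vec_def)
  qed
  have inj: "x = y" if eq: "\<And>k. lawrence A $ k $ x = lawrence A $ k $ y" for x y
  proof (cases x; cases y)
    fix a b assume "x = Inl a" "y = Inl b"
    then show ?thesis using eq[of "Inr a"] by (simp add: lawrence_def mat_def split: if_splits)
  next
    fix a b assume xy: "x = Inl a" "y = Inr b"
    obtain i where "A $ i $ a \<noteq> 0" using nz by blast
    then show ?thesis using eq[of "Inl i"] xy by (simp add: lawrence_def)
  next
    fix a b assume xy: "x = Inr a" "y = Inl b"
    obtain i where "A $ i $ b \<noteq> 0" using nz by blast
    then show ?thesis using eq[of "Inl i"] xy by (simp add: lawrence_def)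
  next
    fix a b assume "x = Inr a" "y = Inr b"
    then show ?thesis using eq[of "Inr a"] by (simp add: lawrence_def mat_def split: if_splits)
  qed
  have "inj (\<lambda>j. column j (lawrence A))"
    by (rule injI) (auto intro: inj simp: column_def vec_eq_iff)
  moreover have "(\<chi> i. case i of Inl _ \<Rightarrow> 0 | Inr _ \<Rightarrow> 1) \<bullet> (\<chi> i. real (lawrence A $ i $ j)) = 1" for j
  proof -
    have UNIV_sum: "(\<Sum>i\<in>UNIV. f i) = (\<Sum>i\<in>UNIV. f (Inl i)) + (\<Sum>i\<in>UNIV. f (Inr i))"
      for f :: "'d + 'n \<Rightarrow> real"
      using sum.Plus[of UNIV UNIV f] by (simp add: comp_def)
    have "(\<Sum>i\<in>UNIV. real (lawrence A $ Inr i $ j)) =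
          (\<Sum>i\<in>UNIV. if i = (case j of Inl c \<Rightarrow> c | Inr c \<Rightarrow> c) then 1 else 0)"
      by (rule sum.cong) (auto simp: lawrence_def mat_def split: sum.splits)
    then show ?thesis
      by (simp add: inner_vec_def UNIV_sum)
  qed
  ultimately show ?thesis unfolding configuration_def by blast
qed

end

theory Submission
  imports Defs
begin

text \<open>
  Unimodularity of \<open>A\<close> is a property of the rational kernel \<open>L\<close> of the matrix \<open>A\<close>, and the proof
  passes through a criterion that mentions neither monomial orders nor the field. A circuit is a
  nonzero vector of \<open>L\<close> whose support is minimal; \<open>integral_circuits A\<close> says that all ratios of
  nonzero entries of a circuit are integers, hence \<open>\<plusminus>1\<close>, so that each circuit is a multiple of a
  vector with entries in \<open>{-1, 0, 1}\<close>. Three facts give the equivalences.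

  \<^item> \<open>A\<close> is unimodular iff \<open>integral_circuits A\<close>. If the circuits are integral, each vector of \<open>L\<close>
    contains, without change of signs, a vector of \<open>L\<close> with entries in \<open>{-1, 0, 1}\<close>
    (\<open>conformal_sign_vector\<close>). Such vectors can be split off a binomial of \<open>toric_ideal A\<close> until
    one of them has its positive part as leading exponent, and this positive part is a squarefree
    divisor of the leading exponent of the binomial (\<open>squarefree_binomial_below\<close>). Conversely, for a
    circuit \<open>u\<close> with \<open>u i > 0\<close> take a lexicographic order that looks first at the variables outside
    the support of \<open>u\<close> and then at \<open>i\<close>. A squarefree leading exponent that divides the positive part
    of an integral multiple of \<open>u\<close> comes from a pair of monomials in the variables of the support.
    Their difference is a multiple of \<open>u\<close> with entry \<open>1\<close> at \<open>i\<close>, and it is integral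
    (\<open>unimodular_imp_integral_circuits\<close>).

  \<^item> The kernel of \<open>lawrence A\<close> consists of the vectors \<open>(u, -u)\<close> with \<open>u\<close> in \<open>L\<close>, so the
    criterion holds for \<open>lawrence A\<close> iff it holds for \<open>A\<close>.

  \<^item> \<open>integral_circuits B\<close> implies that \<open>B\<close> is normal, in particular very ample: an integral
    representation of a point of the cone is corrected by the sign vectors above until its
    coefficients are nonnegative (\<open>natural_representative\<close>). For \<open>B = lawrence A\<close> the converse holds:
    a circuit \<open>u\<close> with \<open>u i = 1\<close> and some non-integral entry yields infinitely many holes,
    because the rows of the identity blocks bound the coefficients of a representation, and the
    bound \<open>0\<close> at \<open>i\<close> prevents any motion along \<open>u\<close>
    (\<open>very_ample_lawrence_imp_integral_circuits\<close>).
\<close>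

section \<open>Circuits of a matrix\<close>

definition rat_kernel :: "nat ^ 'n ^ 'd \<Rightarrow> ('n \<Rightarrow> rat) set" where
  "rat_kernel A = {u. \<forall>i. (\<Sum>j\<in>UNIV. of_nat (A $ i $ j) * u j) = 0}"

definition support :: "('n \<Rightarrow> rat) \<Rightarrow> 'n set" where
  "support u = {j. u j \<noteq> 0}"

definition circuit :: "nat ^ 'n ^ 'd \<Rightarrow> ('n \<Rightarrow> rat) \<Rightarrow> bool" where
  "circuit A u \<longleftrightarrow> u \<in> rat_kernel A \<and> support u \<noteq> {} \<and>
     (\<forall>w\<in>rat_kernel A. support w \<subset> support u \<longrightarrow> support w = {})"

text \<open>
  Exchanging \<open>i\<close> and \<open>j\<close> shows that both ratios are integers, so all nonzero entries of a circuit
  have the same absolute value. Stated with ratios, the condition needs no choice of a primitive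
  integral multiple of the circuit.
\<close>

definition integral_circuits :: "nat ^ 'n ^ 'd \<Rightarrow> bool" where
  "integral_circuits A \<longleftrightarrow>
     (\<forall>u i j. circuit A u \<longrightarrow> u i \<noteq> 0 \<longrightarrow> u j / u i \<in> \<int>)"

definition conformal :: "('n \<Rightarrow> rat) \<Rightarrow> ('n \<Rightarrow> rat) \<Rightarrow> bool" where
  "conformal c u \<longleftrightarrow> (\<forall>j. c j \<noteq> 0 \<longrightarrow> c j * u j > 0)"

lemma conformal_refl: "conformal u u"
  by (auto simp: conformal_def zero_less_mult_iff)

lemma conformal_trans: "conformal a b \<Longrightarrow> conformal b c \<Longrightarrow> conformal a c"
  unfolding conformal_def by (metis zero_less_mult_iff not_less_iff_gr_or_eq)

lemma rat_kernel_diff: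
  assumes "u \<in> rat_kernel A" "v \<in> rat_kernel A"
  shows "(\<lambda>j. u j - t * v j) \<in> rat_kernel A"
proof -
  have "(\<Sum>j\<in>UNIV. of_nat (A $ i $ j) * (u j - t * v j)) =
      (\<Sum>j\<in>UNIV. of_nat (A $ i $ j) * u j) - t * (\<Sum>j\<in>UNIV. of_nat (A $ i $ j) * v j)" for i
  proof -
    have "(\<Sum>j\<in>UNIV. of_nat (A $ i $ j) * (u j - t * v j)) =
      (\<Sum>j\<in>UNIV. of_nat (A $ i $ j) * u j - t * (of_nat (A $ i $ j) * v j))"
      by (rule sum.cong[OF refl]) (simp only: right_diff_distrib mult.left_commute)
    then show ?thesis by (simp only: sum_subtractf sum_distrib_left)
  qed
  then show ?thesis using assms by (simp add: rat_kernel_def)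
qed

lemma rat_kernel_scale: "u \<in> rat_kernel A \<Longrightarrow> (\<lambda>j. t * u j) \<in> rat_kernel A"
  using rat_kernel_diff[of "\<lambda>_. 0" A u "- t"] by (simp add: rat_kernel_def)

lemma circuit_in_rat_kernel: "circuit A u \<Longrightarrow> u \<in> rat_kernel A"
  by (simp add: circuit_def)

lemma circuit_nonzero:
  assumes "circuit A u"
  obtains k where "u k \<noteq> 0"
proof -
  have "support u \<noteq> {}" using assms unfolding circuit_def by blast
  then show thesis using that by (auto simp: support_def)
qed

lemma circuit_scale:
  assumes "circuit A u" "t \<noteq> 0"
  shows "circuit A (\<lambda>j. t * u j)"
proof -
  have "support (\<lambda>j. t * u j) = support u" using assms(2) by (simp add: support_def)
  then show ?thesis using assms(1) rat_kernel_scale[of u A t] unfolding circuit_def by simp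
qed

text \<open>
  Subtracting the multiple of \<open>u\<close> that agrees with \<open>w\<close> at \<open>i\<close> leaves a vector of smaller support.
\<close>

lemma circuit_proportional:
  assumes "circuit A u" "w \<in> rat_kernel A" "support w \<subseteq> support u" "u i \<noteq> 0"
  shows "w j = w i / u i * u j"
proof -
  let ?v = "\<lambda>j. w j - w i / u i * u j"
  have "u \<in> rat_kernel A" using assms(1) by (simp add: circuit_def)
  then have "?v \<in> rat_kernel A" by (rule rat_kernel_diff[OF assms(2)])
  moreover have "support ?v \<subset> support u"
  proof -
    have "i \<in> support u" "i \<notin> support ?v" using assms by (auto simp: support_def)
    moreover have "support ?v \<subseteq> support u" using assms(3) by (auto simp: support_def)
    ultimately show ?thesis by blast
  qed
  ultimately have "support ?v = {}" using assms(1) unfolding circuit_def by blast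
  then have "j \<notin> support ?v" by simp
  then show ?thesis by (simp add: support_def)
qed

text \<open>
  Moving from \<open>u\<close> in the direction \<open>- g\<close>, the step \<open>t\<close> is the first moment at which an entry of
  \<open>u\<close> becomes zero; up to that moment no entry changes its sign.
\<close>

lemma conformal_reduction:
  fixes u g :: "'n::finite \<Rightarrow> rat"
  assumes "support g \<subseteq> support u" "g k * u k > 0"
  obtains t where "conformal (\<lambda>j. u j - t * g j) u" "support (\<lambda>j. u j - t * g j) \<subset> support u"
proof -
  define T where "T = (\<lambda>j. u j / g j) ` {j. g j * u j > 0}"
  have T: "finite T" "T \<noteq> {}" using assms(2) by (auto simp: T_def)
  define t where "t = Min T"
  obtain m where m: "g m * u m > 0" "t = u m / g m"
    using Min_in[OF T] by (auto simp: T_def t_def)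
  have t: "t > 0" using m by (auto simp: zero_less_divide_iff zero_less_mult_iff)
  have nonneg: "(u j - t * g j) * u j \<ge> 0" for j
    unfolding left_diff_distrib mult.assoc diff_ge_0_iff_ge
  proof (cases "g j * u j > 0")
    case True
    then have "t \<le> u j / g j" using T(1) by (auto simp: t_def T_def)
    then have "t * (g j * u j) \<le> (u j / g j) * (g j * u j)"
      using True by (intro mult_right_mono) auto
    also have "\<dots> = u j * u j" using True by auto
    finally show "t * (g j * u j) \<le> u j * u j" .
  next
    case False
    then have "t * (g j * u j) \<le> 0"
      using t by (metis less_imp_le linorder_not_less mult_nonneg_nonpos)
    moreover have "u j * u j \<ge> 0" by simp
    ultimately show "t * (g j * u j) \<le> u j * u j" by linarith
  qed
  have zero: "u j = 0 \<Longrightarrow> g j = 0" for j using assms(1) by (auto simp: support_def)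
  have "conformal (\<lambda>j. u j - t * g j) u"
    unfolding conformal_def
  proof (intro allI impI)
    fix j assume j: "u j - t * g j \<noteq> 0"
    then have "u j \<noteq> 0" using zero by auto
    then have "(u j - t * g j) * u j \<noteq> 0" using j by simp
    then show "0 < (u j - t * g j) * u j" using nonneg[of j] by linarith
  qed
  moreover have "support (\<lambda>j. u j - t * g j) \<subset> support u"
  proof -
    have "m \<in> support u" "m \<notin> support (\<lambda>j. u j - t * g j)" using m by (auto simp: support_def)
    moreover have "support (\<lambda>j. u j - t * g j) \<subseteq> support u" using zero by (auto simp: support_def)
    ultimately show ?thesis by blast
  qed
  ultimately show thesis by (rule that)
qed

text \<open>
  A vector that is not a circuit can be reduced along a kernel vector of smaller support. The result
  is nonzero because it agrees with \<open>u\<close> at an entry where that kernel vector vanishes.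
\<close>

lemma conformal_circuit_exists:
  fixes A :: "nat ^ 'n ^ 'd"
  assumes "u \<in> rat_kernel A" "support u \<noteq> {}"
  shows "\<exists>c. circuit A c \<and> conformal c u"
  using assms
proof (induction "card (support u)" arbitrary: u rule: less_induct)
  case less
  show ?case
  proof (cases "circuit A u")
    case True
    then show ?thesis using conformal_refl by blast
  next
    case False
    then obtain g where g: "g \<in> rat_kernel A" "support g \<subset> support u" "support g \<noteq> {}"
      using less.prems by (auto simp: circuit_def)
    obtain k where k: "g k \<noteq> 0" using g by (auto simp: support_def)
    then have uk: "u k \<noteq> 0" using g(2) by (auto simp: support_def)
    \<comment> \<open>the sign makes \<open>h\<close> and \<open>u\<close> agree in sign at \<open>k\<close>\<close>
    define h where "h = (\<lambda>j. sgn (g k * u k) * g j)"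
    have sgn: "sgn (g k * u k) \<noteq> 0" using k uk by (simp add: sgn_eq_0_iff)
    have h: "h \<in> rat_kernel A" "support h = support g"
      using rat_kernel_scale[OF g(1)] sgn by (auto simp: h_def support_def)
    have "h k * u k = \<bar>g k * u k\<bar>" unfolding h_def abs_sgn by (simp only: mult_ac)
    then have "h k * u k > 0" using k uk by simp
    then obtain t where t: "conformal (\<lambda>j. u j - t * h j) u"
        "support (\<lambda>j. u j - t * h j) \<subset> support u"
      using conformal_reduction[of h u k] g(2) h(2) by blast
    obtain l where "u l \<noteq> 0" "h l = 0" using g(2) h(2) by (auto simp: support_def)
    then have "support (\<lambda>j. u j - t * h j) \<noteq> {}" by (force simp: support_def)
    moreover have "card (support (\<lambda>j. u j - t * h j)) < card (support u)"
      using t(2) by (intro psubset_card_mono) auto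
    ultimately obtain c where "circuit A c" "conformal c (\<lambda>j. u j - t * h j)"
      using less.hyps rat_kernel_diff[OF less.prems(1) h(1)] by blast
    then show ?thesis using t(1) conformal_trans by blast
  qed
qed

lemma sgn_circuit_in_rat_kernel:
  fixes A :: "nat ^ 'n ^ 'd"
  assumes "integral_circuits A" "circuit A c"
  shows "(\<lambda>j. sgn (c j)) \<in> rat_kernel A"
proof -
  obtain k where k: "c k \<noteq> 0" using circuit_nonzero[OF assms(2)] .
  have le: "\<bar>c i\<bar> \<le> \<bar>c j\<bar>" if nz: "c i \<noteq> 0" "c j \<noteq> 0" for i j
  proof -
    have "c j / c i \<in> \<int>" using assms nz unfolding integral_circuits_def by blast
    then have "\<bar>c j / c i\<bar> \<ge> 1" using nz by (intro Ints_nonzero_abs_ge1) auto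
    then show ?thesis using nz by (simp add: field_simps)
  qed
  have "sgn (c j) = (1 / \<bar>c k\<bar>) * c j" for j
    using le[of j k] le[of k j] k by (cases "c j = 0") (auto simp: sgn_if field_simps)
  then show ?thesis
    using rat_kernel_scale[OF circuit_in_rat_kernel[OF assms(2)], of "1 / \<bar>c k\<bar>"] by presburger
qed

text \<open>
  The conformal circuit may vanish at the prescribed entry \<open>k\<close>. In that case it is used to shrink the
  support of \<open>u\<close>, which leaves the entry at \<open>k\<close> untouched.
\<close>

lemma conformal_sign_vector:
  fixes A :: "nat ^ 'n ^ 'd"
  assumes "integral_circuits A" "u \<in> rat_kernel A" "u k \<noteq> 0"
  shows "\<exists>s\<in>rat_kernel A. s k \<noteq> 0 \<and> conformal s u \<and> (\<forall>j. s j \<in> {-1, 0, 1})"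
  using assms(2,3)
proof (induction "card (support u)" arbitrary: u rule: less_induct)
  case less
  have "support u \<noteq> {}" using less.prems by (auto simp: support_def)
  then obtain c where c: "circuit A c" "conformal c u"
    using conformal_circuit_exists less.prems by blast
  show ?case
  proof (cases "c k = 0")
    case False
    have "conformal (\<lambda>j. sgn (c j)) u"
      unfolding conformal_def
    proof (intro allI impI)
      fix j assume "sgn (c j) \<noteq> 0"
      then have "c j * u j > 0" using c(2) by (simp add: conformal_def sgn_eq_0_iff)
      then show "sgn (c j) * u j > 0"
        by (cases "c j > 0") (simp_all add: sgn_if zero_less_mult_iff)
    qed
    moreover have "sgn (c j) \<in> {-1, 0, 1}" for j by (simp add: sgn_if)
    moreover have "sgn (c k) \<noteq> 0" using False by (simp add: sgn_eq_0_iff)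
    ultimately show ?thesis using sgn_circuit_in_rat_kernel[OF assms(1) c(1)]
      by (intro bexI[of _ "\<lambda>j. sgn (c j)"]) auto
  next
    case True
    obtain m where "c m \<noteq> 0" using circuit_nonzero[OF c(1)] .
    then have "c m * u m > 0" using c(2) by (auto simp: conformal_def)
    moreover have "support c \<subseteq> support u" using c(2) by (auto simp: conformal_def support_def)
    ultimately obtain t where t: "conformal (\<lambda>j. u j - t * c j) u"
        "support (\<lambda>j. u j - t * c j) \<subset> support u"
      using conformal_reduction[of c u m] by blast
    have "card (support (\<lambda>j. u j - t * c j)) < card (support u)"
      using t(2) by (intro psubset_card_mono) auto
    moreover have "(\<lambda>j. u j - t * c j) \<in> rat_kernel A"
      by (rule rat_kernel_diff[OF less.prems(1) circuit_in_rat_kernel[OF c(1)]])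
    moreover have "u k - t * c k \<noteq> 0" using True less.prems by simp
    ultimately obtain s where "s \<in> rat_kernel A" "s k \<noteq> 0" "conformal s (\<lambda>j. u j - t * c j)"
        "\<forall>j. s j \<in> {-1, 0, 1}"
      using less.hyps by blast
    then show ?thesis using t(1) conformal_trans by blast
  qed
qed

section \<open>Binomials in toric ideals\<close>

definition exponent :: "('v::finite \<Rightarrow> nat) \<Rightarrow> 'v \<Rightarrow>\<^sub>0 nat" where
  "exponent f = (\<Sum>i\<in>UNIV. Poly_Mapping.single i (f i))"

lemma lookup_exponent [simp]: "Poly_Mapping.lookup (exponent f) i = f i"
  by (simp add: exponent_def lookup_sum Poly_Mapping.lookup_single when_def)

definition multidegree :: "nat ^ 'n ^ 'd \<Rightarrow> ('n \<Rightarrow>\<^sub>0 nat) \<Rightarrow> 'd \<Rightarrow>\<^sub>0 nat" where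
  "multidegree A u = exponent (\<lambda>i. \<Sum>j\<in>UNIV. A $ i $ j * Poly_Mapping.lookup u j)"

lemma var_power: "(var i :: ('v, 'k::field) mpoly) ^ m = Poly_Mapping.single (Poly_Mapping.single i m) 1"
  by (induction m) (simp_all add: var_def mult_single flip: single_add)

lemma prod_single_one:
  "(\<Prod>i\<in>I. Poly_Mapping.single (f i) 1 :: ('v, 'k::field) mpoly) = Poly_Mapping.single (\<Sum>i\<in>I. f i) 1"
  by (induction I rule: infinite_finite_induct) (simp_all add: mult_single)

lemma toric_hom_monomial:
  fixes A :: "nat ^ 'n ^ 'd"
  shows "(\<Prod>j\<in>UNIV. monomial (column j A) ^ Poly_Mapping.lookup u j :: ('d, 'k::field) mpoly) =
    Poly_Mapping.single (multidegree A u) 1"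
proof -
  have "(monomial (column j A) :: ('d, 'k) mpoly) ^ m =
      Poly_Mapping.single (\<Sum>i\<in>UNIV. Poly_Mapping.single i (A $ i $ j * m)) 1" for j m
    unfolding monomial_def prod_power_distrib power_mult[symmetric]
    unfolding var_power prod_single_one
    by (simp add: column_def)
  moreover have "(\<Sum>j\<in>UNIV. \<Sum>i\<in>UNIV. Poly_Mapping.single i (A $ i $ j * Poly_Mapping.lookup u j)) =
      multidegree A u"
    by (intro poly_mapping_eqI)
       (simp add: multidegree_def lookup_sum Poly_Mapping.lookup_single when_def)
  ultimately show ?thesis by (simp add: prod_single_one)
qed

lemma lookup_toric_hom:
  fixes f :: "('n::finite, 'k::field) mpoly"
  shows "Poly_Mapping.lookup (toric_hom A f) e =
     (\<Sum>u\<in>Poly_Mapping.keys f. if multidegree A u = e then Poly_Mapping.lookup f u else 0)"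
proof -
  have "toric_hom A f = (\<Sum>u\<in>Poly_Mapping.keys f. Poly_Mapping.single (multidegree A u) (Poly_Mapping.lookup f u))"
    unfolding toric_hom_def toric_hom_monomial by (simp add: scalar_def mult_single)
  then show ?thesis by (simp add: lookup_sum Poly_Mapping.lookup_single when_def)
qed

text \<open>
  If no other monomial of \<open>f\<close> had the multidegree of \<open>u\<close>, the term of \<open>u\<close> could not cancel in the
  image of \<open>f\<close>.
\<close>

lemma toric_ideal_key_partner:
  fixes f :: "('n::finite, 'k::field) mpoly"
  assumes "f \<in> toric_ideal A" "u \<in> Poly_Mapping.keys f"
  obtains v where "v \<in> Poly_Mapping.keys f" "v \<noteq> u" "multidegree A v = multidegree A u"
proof (rule ccontr)
  assume "\<not> thesis"
  then have alone: "v \<in> Poly_Mapping.keys f \<Longrightarrow> multidegree A v = multidegree A u \<longleftrightarrow> v = u" for v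
    using that by blast
  have "Poly_Mapping.lookup (toric_hom A f) (multidegree A u) =
      (\<Sum>v\<in>Poly_Mapping.keys f. if v = u then Poly_Mapping.lookup f v else 0)"
    unfolding lookup_toric_hom by (intro sum.cong refl) (simp add: alone)
  also have "\<dots> = Poly_Mapping.lookup f u" using assms(2) by simp
  finally show False using assms by (simp add: toric_ideal_def in_keys_iff)
qed

lemma multidegree_eq_iff:
  fixes A :: "nat ^ 'n ^ 'd"
  shows "multidegree A u = multidegree A v \<longleftrightarrow>
    (\<lambda>j. of_nat (Poly_Mapping.lookup u j) - of_nat (Poly_Mapping.lookup v j)) \<in> rat_kernel A"
proof -
  let ?deg = "\<lambda>w i. \<Sum>j\<in>UNIV. A $ i $ j * Poly_Mapping.lookup w j"
  have "(\<Sum>j\<in>UNIV. of_nat (A $ i $ j) * (of_nat (Poly_Mapping.lookup u j) - of_nat (Poly_Mapping.lookup v j))) =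
      (of_nat (?deg u i) - of_nat (?deg v i) :: rat)" for i
    by (simp only: right_diff_distrib sum_subtractf of_nat_sum of_nat_mult)
  then have "(\<lambda>j. of_nat (Poly_Mapping.lookup u j) - of_nat (Poly_Mapping.lookup v j)) \<in> rat_kernel A
      \<longleftrightarrow> (\<forall>i. ?deg u i = ?deg v i)"
    unfolding rat_kernel_def mem_Collect_eq by (simp only: eq_iff_diff_eq_0[symmetric] of_nat_eq_iff)
  moreover have "multidegree A u = multidegree A v \<longleftrightarrow> (\<forall>i. ?deg u i = ?deg v i)"
    unfolding multidegree_def by (metis (mono_tags, lifting) lookup_exponent poly_mapping_eqI)
  ultimately show ?thesis by blast
qed

section \<open>Monomial orders and leading exponents\<close>

lemma monomial_orderD:
  assumes "monomial_order r"
  shows "(u, u) \<in> r" "(u, v) \<in> r \<Longrightarrow> (v, w) \<in> r \<Longrightarrow> (u, w) \<in> r"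
    "(u, v) \<in> r \<Longrightarrow> (v, u) \<in> r \<Longrightarrow> u = v" "(u, v) \<in> r \<or> (v, u) \<in> r"
    "(u, v) \<in> r \<Longrightarrow> (u + w, v + w) \<in> r"
proof -
  have lin: "refl r" "trans r" "antisym r" "total r"
    using assms by (auto simp: monomial_order_def order_on_defs)
  show "(u, u) \<in> r" using lin(1) by (rule reflD)
  show "(u, v) \<in> r \<Longrightarrow> (v, w) \<in> r \<Longrightarrow> (u, w) \<in> r" using lin(2) by (rule transD)
  show "(u, v) \<in> r \<Longrightarrow> (v, u) \<in> r \<Longrightarrow> u = v" using lin(3) by (rule antisymD)
  show "(u, v) \<in> r \<or> (v, u) \<in> r" using lin(1,4) by (metis UNIV_I refl_onD total_on_def)
  show "(u, v) \<in> r \<Longrightarrow> (u + w, v + w) \<in> r" using assms by (auto simp: monomial_order_def)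
qed

lemma monomial_order_cancel:
  assumes "monomial_order r" "(u + w, v + w) \<in> r"
  shows "(u, v) \<in> r"
  using monomial_orderD[OF assms(1)] assms(2) by (metis add_right_cancel)

lemma lead_exp_eqI:
  assumes "monomial_order r" "u \<in> Poly_Mapping.keys f" "\<And>v. v \<in> Poly_Mapping.keys f \<Longrightarrow> (v, u) \<in> r"
  shows "lead_exp r f = u"
  unfolding lead_exp_def using assms(2,3) monomial_orderD(3)[OF assms(1)] by (intro the_equality) blast+

lemma lead_exp_max:
  assumes "monomial_order r" "f \<noteq> 0"
  shows "lead_exp r f \<in> Poly_Mapping.keys f" "v \<in> Poly_Mapping.keys f \<Longrightarrow> (v, lead_exp r f) \<in> r"
proof -
  have "\<exists>u\<in>S. \<forall>v\<in>S. (v, u) \<in> r" if "finite S" "S \<noteq> {}" for S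
    using that
  proof (induction S rule: finite_ne_induct)
    case (singleton x)
    then show ?case using monomial_orderD(1)[OF assms(1)] by simp
  next
    case (insert x F)
    then obtain u where u: "u \<in> F" "\<forall>v\<in>F. (v, u) \<in> r" by blast
    show ?case
    proof (cases "(x, u) \<in> r")
      case True
      then show ?thesis using u by blast
    next
      case False
      then have "(u, x) \<in> r" using monomial_orderD(4)[OF assms(1)] by blast
      then have "\<forall>v\<in>insert x F. (v, x) \<in> r"
        using u(2) monomial_orderD(1,2)[OF assms(1)] by blast
      then show ?thesis by blast
    qed
  qed
  from this[of "Poly_Mapping.keys f"] obtain u
    where u: "u \<in> Poly_Mapping.keys f" "\<forall>v\<in>Poly_Mapping.keys f. (v, u) \<in> r"
    using assms(2) by auto
  then have "lead_exp r f = u" by (intro lead_exp_eqI[OF assms(1)]) auto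
  then show "lead_exp r f \<in> Poly_Mapping.keys f" "v \<in> Poly_Mapping.keys f \<Longrightarrow> (v, lead_exp r f) \<in> r"
    using u by auto
qed

definition lead_exps :: "('v \<Rightarrow>\<^sub>0 nat) rel \<Rightarrow> ('v, 'k::zero) mpoly set \<Rightarrow> ('v \<Rightarrow>\<^sub>0 nat) set" where
  "lead_exps r I = {lead_exp r f | f. f \<in> I \<and> f \<noteq> 0}"

definition monomial_ideal :: "('v \<Rightarrow>\<^sub>0 nat) set \<Rightarrow> ('v, 'k::field) mpoly set" where
  "monomial_ideal S = ideal ((\<lambda>u. Poly_Mapping.single u 1) ` S)"

lemma initial_ideal_eq: "initial_ideal r I = monomial_ideal (lead_exps r I)"
  unfolding initial_ideal_def monomial_ideal_def lead_exps_def
  by (rule arg_cong[where f = ideal]) blast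

text \<open>
  The polynomials all of whose monomials are divisible by an element of \<open>S\<close> form an ideal.
\<close>

lemma single_in_monomial_ideal_iff:
  "(Poly_Mapping.single u 1 :: ('v, 'k::field) mpoly) \<in> monomial_ideal S \<longleftrightarrow> (\<exists>s\<in>S. \<exists>w. u = s + w)"
proof
  assume mem: "(Poly_Mapping.single u 1 :: ('v, 'k) mpoly) \<in> monomial_ideal S"
  let ?P = "\<lambda>p :: ('v, 'k) mpoly. \<forall>u\<in>Poly_Mapping.keys p. \<exists>s\<in>S. \<exists>w. u = s + w"
  have "?P p" if "p \<in> monomial_ideal S" for p
    using that unfolding monomial_ideal_def
  proof (rule ideal.span_induct)
    show "ideal.subspace (Collect ?P)"
    proof (rule ideal.subspaceI)
      show "0 \<in> Collect ?P" by simp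
    next
      fix p q assume "p \<in> Collect ?P" "q \<in> Collect ?P"
      then show "p + q \<in> Collect ?P" using keys_add[of p q] by blast
    next
      fix c p assume p: "p \<in> Collect ?P"
      show "c * p \<in> Collect ?P"
      proof (intro CollectI ballI)
        fix e assume "e \<in> Poly_Mapping.keys (c * p)"
        then obtain a b where ab: "e = a + b" "b \<in> Poly_Mapping.keys p"
          using keys_mult[of c p] by blast
        then obtain s w where "s \<in> S" "b = s + w" using p by blast
        then show "\<exists>s\<in>S. \<exists>w. e = s + w" using ab(1) by (metis add.left_commute)
      qed
    qed
  next
    fix q :: "('v, 'k) mpoly" assume "q \<in> (\<lambda>u. Poly_Mapping.single u 1) ` S"
    then obtain s where "s \<in> S" "q = Poly_Mapping.single s 1" by blast
    then show "?P q" by (auto intro!: bexI[of _ s] exI[of _ 0])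
  qed
  from this[OF mem] show "\<exists>s\<in>S. \<exists>w. u = s + w" by simp
next
  assume "\<exists>s\<in>S. \<exists>w. u = s + w"
  then obtain s w where s: "s \<in> S" "u = s + w" by blast
  then have "(Poly_Mapping.single s 1 :: ('v, 'k) mpoly) \<in> monomial_ideal S"
    unfolding monomial_ideal_def by (intro ideal.span_base) blast
  then have "Poly_Mapping.single w 1 * (Poly_Mapping.single s 1 :: ('v, 'k) mpoly) \<in> monomial_ideal S"
    unfolding monomial_ideal_def by (rule ideal.span_scale)
  then show "(Poly_Mapping.single u 1 :: ('v, 'k) mpoly) \<in> monomial_ideal S"
    using s by (simp add: mult_single add.commute)
qed

lemma binomial_lead_exp:
  fixes A :: "nat ^ 'n ^ 'd"
  assumes "monomial_order r" "multidegree A c = multidegree A e" "(e, c) \<in> r" "e \<noteq> c"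
  shows "c \<in> lead_exps r (toric_ideal A :: ('n, 'k::field) mpoly set)"
proof -
  define f :: "('n, 'k) mpoly" where "f = Poly_Mapping.single c 1 + Poly_Mapping.single e (- 1)"
  have "toric_hom A f = 0"
    unfolding f_def toric_hom_add toric_hom_single toric_hom_monomial assms(2)
    by (simp add: scalar_def mult_single flip: single_add)
  moreover have keys: "Poly_Mapping.keys f = {c, e}"
    using assms(4) by (auto simp: f_def in_keys_iff Poly_Mapping.lookup_add Poly_Mapping.lookup_single when_def split: if_splits)
  moreover have "lead_exp r f = c"
    using assms(3) monomial_orderD(1)[OF assms(1)] by (intro lead_exp_eqI[OF assms(1)]) (auto simp: keys)
  moreover have "f \<noteq> 0" using keys by auto
  ultimately show ?thesis unfolding lead_exps_def toric_ideal_def by blast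
qed

text \<open>
  Let \<open>s\<close> be a sign vector conformal to \<open>u - v\<close>, with positive part \<open>c\<close> and negative part \<open>e\<close>.
  Then \<open>c\<close> divides \<open>u\<close> and \<open>e\<close> divides \<open>v\<close>. If \<open>c\<close> is the larger of the two, it is the exponent
  wanted. Otherwise \<open>u - c\<close> is still larger than \<open>v - e\<close>, since the smaller exponent was removed
  from the larger side, and the total degree has dropped.
\<close>

lemma squarefree_binomial_below:
  fixes A :: "nat ^ 'n ^ 'd"
  assumes r: "monomial_order r" and A: "integral_circuits A"
    and "multidegree A u = multidegree A v" "(v, u) \<in> r" "v \<noteq> u"
  shows "\<exists>c e w. squarefree_exp c \<and> multidegree A c = multidegree A e \<and> (e, c) \<in> r \<and> e \<noteq> c \<and> u = c + w"
  using assms(3-)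
proof (induction "\<Sum>j\<in>UNIV. Poly_Mapping.lookup u j + Poly_Mapping.lookup v j"
    arbitrary: u v rule: less_induct)
  case less
  let ?x = "\<lambda>j. of_nat (Poly_Mapping.lookup u j) - of_nat (Poly_Mapping.lookup v j) :: rat"
  have x: "?x \<in> rat_kernel A" using less.prems(1) multidegree_eq_iff by blast
  obtain k where "Poly_Mapping.lookup u k \<noteq> Poly_Mapping.lookup v k"
    using less.prems(3) by (metis poly_mapping_eqI)
  then have "?x k \<noteq> 0" by simp
  then obtain s where s: "s \<in> rat_kernel A" "s k \<noteq> 0" "conformal s ?x" "\<And>j. s j \<in> {-1, 0, 1}"
    using conformal_sign_vector[OF A x, of k] by blast
  define c where "c = exponent (\<lambda>j. if s j = 1 then 1 else 0)"
  define e where "e = exponent (\<lambda>j. if s j = -1 then 1 else 0)"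
  define u' where "u' = exponent (\<lambda>j. Poly_Mapping.lookup u j - (if s j = 1 then 1 else 0))"
  define v' where "v' = exponent (\<lambda>j. Poly_Mapping.lookup v j - (if s j = -1 then 1 else 0))"
  have "Poly_Mapping.lookup u j > Poly_Mapping.lookup v j" if "s j = 1" for j
  proof -
    have "s j * ?x j > 0" using s(3) that unfolding conformal_def by (metis zero_neq_one)
    then show ?thesis using that by simp
  qed
  then have u: "u = c + u'"
    by (intro poly_mapping_eqI) (fastforce simp: c_def u'_def Poly_Mapping.lookup_add)
  have "Poly_Mapping.lookup u j < Poly_Mapping.lookup v j" if "s j = -1" for j
  proof -
    have "s j \<noteq> 0" using that by simp
    then have "s j * ?x j > 0" using s(3) unfolding conformal_def by blast
    then show ?thesis using that by simp
  qed
  then have v: "v = e + v'"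
    by (intro poly_mapping_eqI) (fastforce simp: e_def v'_def Poly_Mapping.lookup_add)
  have ce: "(\<lambda>j. of_nat (Poly_Mapping.lookup c j) - of_nat (Poly_Mapping.lookup e j)) = s"
  proof
    fix j show "of_nat (Poly_Mapping.lookup c j) - of_nat (Poly_Mapping.lookup e j) = s j"
      using s(4)[of j] by (auto simp: c_def e_def)
  qed
  then have deg: "multidegree A c = multidegree A e" using s(1) multidegree_eq_iff by metis
  have "c \<noteq> e" using ce s(2) by auto
  show ?case
  proof (cases "(e, c) \<in> r")
    case True
    moreover have "squarefree_exp c" by (simp add: squarefree_exp_def c_def)
    ultimately show ?thesis using deg u \<open>c \<noteq> e\<close> by metis
  next
    case False
    then have ce_r: "(c, e) \<in> r" using monomial_orderD(4)[OF r] by blast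
    have "(\<lambda>j. ?x j - 1 * s j) \<in> rat_kernel A" by (rule rat_kernel_diff[OF x s(1)])
    moreover have "(\<lambda>j. ?x j - 1 * s j) =
        (\<lambda>j. of_nat (Poly_Mapping.lookup u' j) - of_nat (Poly_Mapping.lookup v' j))"
      unfolding ce[symmetric] u v by (simp add: Poly_Mapping.lookup_add)
    ultimately have deg': "multidegree A u' = multidegree A v'" using multidegree_eq_iff by metis
    have "(c + v', e + v') \<in> r" using monomial_orderD(5)[OF r ce_r] .
    then have "(c + v', c + u') \<in> r" using less.prems(2) monomial_orderD(2)[OF r] unfolding u v by blast
    then have le: "(v', u') \<in> r" using monomial_order_cancel[OF r, of v' c u'] by (simp add: add.commute)
    have ne: "v' \<noteq> u'"
    proof
      assume "v' = u'"
      then have "(e + u', c + u') \<in> r" using less.prems(2) unfolding u v by simp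
      then show False using False monomial_order_cancel[OF r] by blast
    qed
    have "(\<Sum>j\<in>UNIV. Poly_Mapping.lookup u' j + Poly_Mapping.lookup v' j) <
        (\<Sum>j\<in>UNIV. Poly_Mapping.lookup u j + Poly_Mapping.lookup v j)"
    proof (intro sum_strict_mono_ex1)
      have "Poly_Mapping.lookup c k + Poly_Mapping.lookup e k > 0"
        using s(2) s(4)[of k] by (auto simp: c_def e_def)
      then show "\<exists>j\<in>UNIV. Poly_Mapping.lookup u' j + Poly_Mapping.lookup v' j <
          Poly_Mapping.lookup u j + Poly_Mapping.lookup v j"
        unfolding u v Poly_Mapping.lookup_add by (intro bexI[of _ k]) auto
    qed (auto simp: u v Poly_Mapping.lookup_add)
    from less.hyps[OF this deg' le ne] obtain c' e' w where
      "squarefree_exp c'" "multidegree A c' = multidegree A e'" "(e', c') \<in> r" "e' \<noteq> c'" "u' = c' + w"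
      by blast
    moreover from this have "u = c' + (c + w)" unfolding u by (simp add: add.left_commute)
    ultimately show ?thesis by blast
  qed
qed

lemma integral_circuits_imp_unimodular:
  fixes A :: "nat ^ 'n ^ 'd"
  assumes "integral_circuits A"
  shows "unimodular TYPE('k::field) A"
  unfolding unimodular_def
proof (intro allI impI)
  fix r :: "('n \<Rightarrow>\<^sub>0 nat) rel" assume r: "monomial_order r"
  let ?I = "toric_ideal A :: ('n, 'k) mpoly set"
  define S where "S = {c \<in> lead_exps r ?I. squarefree_exp c}"
  have dvd: "\<exists>s\<in>S. \<exists>w. u = s + w" if "u \<in> lead_exps r ?I" for u
  proof -
    obtain f where f: "f \<in> ?I" "f \<noteq> 0" "u = lead_exp r f" using \<open>u \<in> _\<close> by (auto simp: lead_exps_def)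
    then obtain v where v: "v \<in> Poly_Mapping.keys f" "v \<noteq> u" "multidegree A v = multidegree A u"
      using toric_ideal_key_partner lead_exp_max(1)[OF r] by metis
    then have "(v, u) \<in> r" using lead_exp_max(2)[OF r f(2)] f(3) by blast
    then obtain c e w where "squarefree_exp c" "multidegree A c = multidegree A e" "(e, c) \<in> r"
        "e \<noteq> c" "u = c + w"
      using squarefree_binomial_below[OF r assms] v by metis
    then show ?thesis using binomial_lead_exp[OF r] unfolding S_def by blast
  qed
  have "monomial_ideal (lead_exps r ?I) = (monomial_ideal S :: ('n, 'k) mpoly set)"
  proof
    have "Poly_Mapping.single u 1 \<in> (monomial_ideal S :: ('n, 'k) mpoly set)" if "u \<in> lead_exps r ?I" for u
      using dvd[OF that] single_in_monomial_ideal_iff by blast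
    then show "monomial_ideal (lead_exps r ?I) \<subseteq> (monomial_ideal S :: ('n, 'k) mpoly set)"
      unfolding monomial_ideal_def by (intro ideal.span_minimal ideal.subspace_span) blast
    show "(monomial_ideal S :: ('n, 'k) mpoly set) \<subseteq> monomial_ideal (lead_exps r ?I)"
      unfolding monomial_ideal_def S_def by (intro ideal.span_mono) blast
  qed
  then show "generated_by_squarefree_monomials (initial_ideal r ?I)"
    unfolding generated_by_squarefree_monomials_def initial_ideal_eq
    by (intro exI[of _ S]) (auto simp: S_def monomial_ideal_def)
qed

section \<open>Circuits from lexicographic initial ideals\<close>

text \<open>
  The variable with the smallest value of \<open>prio\<close> is compared first.
\<close>

definition lex_order :: "('v \<Rightarrow> nat) \<Rightarrow> ('v \<Rightarrow>\<^sub>0 nat) rel" where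
  "lex_order prio = {(u, v). u = v \<or> (\<exists>k. Poly_Mapping.lookup u k < Poly_Mapping.lookup v k \<and>
     (\<forall>l. prio l < prio k \<longrightarrow> Poly_Mapping.lookup u l = Poly_Mapping.lookup v l))}"

lemma lex_order_first_difference:
  fixes prio :: "'v \<Rightarrow> nat"
  assumes "u \<noteq> v"
  obtains k where "Poly_Mapping.lookup u k \<noteq> Poly_Mapping.lookup v k"
    "\<And>l. prio l < prio k \<Longrightarrow> Poly_Mapping.lookup u l = Poly_Mapping.lookup v l"
proof -
  obtain k0 where "Poly_Mapping.lookup u k0 \<noteq> Poly_Mapping.lookup v k0"
    using assms by (metis poly_mapping_eqI)
  from ex_has_least_nat[of "\<lambda>k. Poly_Mapping.lookup u k \<noteq> Poly_Mapping.lookup v k", OF this, of prio]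
  show thesis using that by (meson not_le)
qed

lemma monomial_order_lex_order:
  assumes "inj prio"
  shows "monomial_order (lex_order prio)"
  unfolding monomial_order_def order_on_defs
proof (intro conjI allI impI)
  let ?L = Poly_Mapping.lookup
  show "refl (lex_order prio)" by (auto simp: refl_on_def lex_order_def)
  show "lex_order prio \<subseteq> UNIV \<times> UNIV" by simp
  show "trans (lex_order prio)"
  proof (rule transI)
    fix u v w assume uv: "(u, v) \<in> lex_order prio" and vw: "(v, w) \<in> lex_order prio"
    show "(u, w) \<in> lex_order prio"
    proof (cases "u = v \<or> v = w")
      case True
      then show ?thesis using uv vw by auto
    next
      case False
      obtain k where k: "?L u k < ?L v k" "\<And>l. prio l < prio k \<Longrightarrow> ?L u l = ?L v l"
        using False uv by (auto simp: lex_order_def)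
      obtain m where m: "?L v m < ?L w m" "\<And>l. prio l < prio m \<Longrightarrow> ?L v l = ?L w l"
        using False vw by (auto simp: lex_order_def)
      define p where "p = (if prio k \<le> prio m then k else m)"
      have p: "prio p \<le> prio k" "prio p \<le> prio m" by (auto simp: p_def)
      have "?L u l = ?L w l" if "prio l < prio p" for l using k(2) m(2) p that by fastforce
      moreover have "?L u p < ?L w p"
      proof (cases "prio k" "prio m" rule: linorder_cases)
        case less
        then have "?L v k = ?L w k" using m(2) by blast
        then show ?thesis using k less by (simp add: p_def)
      next
        case equal
        then have "k = m" using assms by (auto dest: injD)
        then show ?thesis using k m by (simp add: p_def)
      next
        case greater
        then have "?L u m = ?L v m" using k(2) by blast
        then show ?thesis using m greater by (simp add: p_def)
      qed
      ultimately show ?thesis by (auto simp: lex_order_def)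
    qed
  qed
  show "antisym (lex_order prio)"
  proof (rule antisymI, rule ccontr)
    fix u v assume uv: "(u, v) \<in> lex_order prio" and vu: "(v, u) \<in> lex_order prio" and "u \<noteq> v"
    then obtain k m where k: "?L u k < ?L v k" "\<And>l. prio l < prio k \<Longrightarrow> ?L u l = ?L v l"
      and m: "?L v m < ?L u m" "\<And>l. prio l < prio m \<Longrightarrow> ?L v l = ?L u l"
      by (auto simp: lex_order_def)
    have "prio k = prio m" using k m by (metis linorder_neqE_nat less_irrefl)
    then have "k = m" using assms by (auto dest: injD)
    then show False using k m by simp
  qed
  show "total (lex_order prio)"
  proof (rule totalI)
    fix u v :: "'a \<Rightarrow>\<^sub>0 nat" assume "u \<noteq> v"
    then obtain k where "?L u k \<noteq> ?L v k" "\<And>l. prio l < prio k \<Longrightarrow> ?L u l = ?L v l"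
      using lex_order_first_difference by metis
    then show "(u, v) \<in> lex_order prio \<or> (v, u) \<in> lex_order prio"
      unfolding lex_order_def by (cases "?L u k < ?L v k") force+
  qed
next
  fix u :: "'a \<Rightarrow>\<^sub>0 nat"
  show "(0, u) \<in> lex_order prio"
  proof (cases "u = 0")
    case False
    then obtain k where "Poly_Mapping.lookup 0 k \<noteq> Poly_Mapping.lookup u k"
        "\<And>l. prio l < prio k \<Longrightarrow> Poly_Mapping.lookup 0 l = Poly_Mapping.lookup u l"
      using lex_order_first_difference by metis
    moreover from this have "Poly_Mapping.lookup 0 k < Poly_Mapping.lookup u k" by simp
    ultimately show ?thesis unfolding lex_order_def by blast
  qed (simp add: lex_order_def)
next
  fix u v w :: "'a \<Rightarrow>\<^sub>0 nat" assume "(u, v) \<in> lex_order prio"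
  then show "(u + w, v + w) \<in> lex_order prio"
    by (auto simp: lex_order_def Poly_Mapping.lookup_add)
qed

lemma common_denominator:
  fixes u :: "'n::finite \<Rightarrow> rat"
  obtains N :: nat where "N > 0" "\<And>j. of_nat N * u j \<in> \<int>"
proof -
  have "\<exists>N>0. \<forall>j\<in>J. of_nat N * u j \<in> \<int>" if "finite J" for J
    using that
  proof (induction J rule: finite_induct)
    case empty
    then show ?case by (auto intro: exI[of _ "1::nat"])
  next
    case (insert k J)
    then obtain N where N: "(N::nat) > 0" "\<And>j. j \<in> J \<Longrightarrow> of_nat N * u j \<in> \<int>" by blast
    obtain a b where ab: "u k = of_int a / of_int b" "b > 0" by (metis quotient_of_div quotient_of_denom_pos surj_pair)
    have "of_nat (N * nat b) * u j \<in> \<int>" if "j \<in> insert k J" for j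
    proof (cases "j \<in> J")
      case True
      have "of_nat (N * nat b) * u j = of_nat (nat b) * (of_nat N * u j)" by simp
      then show ?thesis using Ints_mult[OF Ints_of_nat N(2)[OF True]] by metis
    next
      case False
      then have "j = k" using that by simp
      then have "of_nat (N * nat b) * u j = of_int (int N * a)" using ab by simp
      then show ?thesis by (metis Ints_of_int)
    qed
    then show ?case using N(1) ab(2) by (intro exI[of _ "N * nat b"]) auto
  qed
  from this[of UNIV] show thesis using that by auto
qed

text \<open>
  Let \<open>c - e\<close> be an integral multiple of a circuit with \<open>c\<close>, \<open>e\<close> its positive and negative parts.
  The order is chosen such that \<open>c\<close> is a leading exponent, and such that a leading exponent supported
  in the circuit belongs to a polynomial whose monomials are all supported there. Squarefree
  generation gives a leading exponent \<open>a\<close> dividing \<open>c\<close> with entries at most \<open>1\<close>, and a smaller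
  exponent \<open>b\<close> of the same multidegree. Then \<open>a - b\<close> is an integral multiple of the circuit whose
  entry at \<open>i\<close> is \<open>1\<close>, because \<open>i\<close> has the highest priority within the circuit.
\<close>

lemma unimodular_imp_integral_circuits:
  fixes A :: "nat ^ 'n ^ 'd"
  assumes "unimodular TYPE('k::field) A"
  shows "integral_circuits A"
  unfolding integral_circuits_def
proof (intro allI impI)
  fix u0 i j assume u0: "circuit A u0" "u0 i \<noteq> 0"
  let ?L = Poly_Mapping.lookup
  obtain N where N: "N > 0" "\<And>k. of_nat N * (sgn (u0 i) * u0 k) \<in> \<int>"
    using common_denominator[of "\<lambda>k. sgn (u0 i) * u0 k"] by blast
  \<comment> \<open>an integral multiple that is positive at \<open>i\<close>\<close>
  define u where "u = (\<lambda>k. (of_nat N * sgn (u0 i)) * u0 k)"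
  have scale: "of_nat N * sgn (u0 i) \<noteq> 0" using N(1) u0(2) by (simp add: sgn_eq_0_iff)
  have u: "circuit A u" using circuit_scale[OF u0(1) scale] by (simp only: u_def)
  have u_Ints: "u k \<in> \<int>" for k using N(2)[of k] by (simp only: u_def mult.assoc)
  have "u i = of_nat N * \<bar>u0 i\<bar>" by (simp only: u_def abs_sgn mult_ac)
  then have ui: "u i > 0" using u0(2) N(1) by simp
  have ratio: "u j / u i = u0 j / u0 i" using scale by (simp add: u_def)
  obtain h :: "'n \<Rightarrow> nat" and n where h: "h ` UNIV = {m. m < n}" "inj h"
    using finite_imp_inj_to_nat_seg[of "UNIV :: 'n set"] by auto
  have hn: "h k < n" for k using h(1) by auto
  \<comment> \<open>priority classes: outside the support, then \<open>i\<close>, then the rest; \<open>h\<close> breaks ties\<close>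
  define prio where "prio = (\<lambda>k. (if k \<notin> support u then 0 else if k = i then 1 else 2) * n + h k)"
  have "inj prio"
  proof (rule injI)
    fix k l assume "prio k = prio l"
    then have "prio k mod n = prio l mod n" by simp
    then have "h k = h l" using hn by (simp add: prio_def)
    then show "k = l" using h(2) by (auto dest: injD)
  qed
  have prio_outside: "prio k < prio l" if "k \<notin> support u" "l \<in> support u" for k l
    using that hn[of k] by (auto simp: prio_def)
  have prio_i: "k \<notin> support u" if "prio k < prio i" for k
  proof
    assume "k \<in> support u"
    moreover have "i \<in> support u" using ui by (simp add: support_def)
    ultimately show False using that hn[of i] by (auto simp: prio_def split: if_splits)
  qed
  define r where "r = lex_order prio"
  have r: "monomial_order r" unfolding r_def using \<open>inj prio\<close> by (rule monomial_order_lex_order)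
  let ?I = "toric_ideal A :: ('n, 'k) mpoly set"

  define c where "c = exponent (\<lambda>k. nat \<lfloor>u k\<rfloor>)"
  define e where "e = exponent (\<lambda>k. nat \<lfloor>- u k\<rfloor>)"
  have "of_nat (?L c k) - of_nat (?L e k) = u k" for k
  proof -
    obtain z where "u k = of_int z" using u_Ints[of k] by (elim Ints_cases)
    then show ?thesis by (cases "z \<ge> 0") (simp_all add: c_def e_def flip: of_int_minus)
  qed
  then have deg: "multidegree A c = multidegree A e"
    unfolding multidegree_eq_iff using circuit_in_rat_kernel[OF u] by simp
  have out: "?L c k = 0 \<and> ?L e k = 0" if "k \<notin> support u" for k
    using that by (simp add: c_def e_def support_def)
  have ci: "?L c i > 0 \<and> ?L e i = 0"
  proof -
    obtain z where "u i = of_int z" using u_Ints[of i] by (elim Ints_cases)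
    then show ?thesis using ui by (simp add: c_def e_def flip: of_int_minus)
  qed
  moreover have "\<forall>l. prio l < prio i \<longrightarrow> ?L e l = ?L c l" using prio_i out by metis
  ultimately have "\<exists>k. ?L e k < ?L c k \<and> (\<forall>l. prio l < prio k \<longrightarrow> ?L e l = ?L c l)"
    by (intro exI[of _ i]) simp
  then have "(e, c) \<in> r" unfolding r_def lex_order_def by blast
  moreover have "e \<noteq> c" using ci by auto
  ultimately have lt: "(e, c) \<in> r" "e \<noteq> c" by blast+
  have "c \<in> lead_exps r ?I" using binomial_lead_exp[OF r deg lt] .
  then have c: "Poly_Mapping.single c 1 \<in> initial_ideal r ?I"
    unfolding initial_ideal_eq single_in_monomial_ideal_iff by (metis add_0_right)
  obtain S where S: "\<forall>s\<in>S. squarefree_exp s" "initial_ideal r ?I = monomial_ideal S"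
    using assms r unfolding unimodular_def generated_by_squarefree_monomials_def monomial_ideal_def
    by blast
  then obtain s w where s: "s \<in> S" "c = s + w" using c single_in_monomial_ideal_iff by metis
  then have "Poly_Mapping.single s 1 \<in> initial_ideal r ?I"
    unfolding S(2) single_in_monomial_ideal_iff by (metis add_0_right)
  then obtain a w' where a: "a \<in> lead_exps r ?I" "s = a + w'"
    unfolding initial_ideal_eq single_in_monomial_ideal_iff by blast
  have a_le1: "?L a k \<le> 1" for k
  proof -
    have "?L s k \<le> 1" using S(1) s(1) by (auto simp: squarefree_exp_def)
    then show ?thesis by (simp add: a(2) Poly_Mapping.lookup_add)
  qed
  have a_out: "?L a k = 0" if "k \<notin> support u" for k
    using out[OF that] by (simp add: s(2) a(2) Poly_Mapping.lookup_add)
  obtain f where f: "f \<in> ?I" "f \<noteq> 0" "a = lead_exp r f" using a(1) by (auto simp: lead_exps_def)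
  then obtain b where b: "b \<in> Poly_Mapping.keys f" "b \<noteq> a" "multidegree A b = multidegree A a"
    using toric_ideal_key_partner lead_exp_max(1)[OF r] by metis
  then have "(b, a) \<in> r" using lead_exp_max(2)[OF r f(2)] f(3) by blast
  then obtain k where k: "?L b k < ?L a k" "\<And>l. prio l < prio k \<Longrightarrow> ?L b l = ?L a l"
    using b(2) by (auto simp: r_def lex_order_def)
  have k_supp: "k \<in> support u" using k(1) a_out by fastforce
  \<comment> \<open>\<open>b\<close> is smaller than \<open>a\<close>, so it cannot use a variable outside the support either\<close>
  have b_out: "?L b l = 0" if "l \<notin> support u" for l
    using k(2)[OF prio_outside[OF that k_supp]] a_out[OF that] by simp
  define x where "x = (\<lambda>l. of_nat (?L a l) - of_nat (?L b l) :: rat)"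
  have "x \<in> rat_kernel A" using b(3) multidegree_eq_iff unfolding x_def by metis
  moreover have "support x \<subseteq> support u"
  proof
    fix l assume "l \<in> support x"
    then show "l \<in> support u" using a_out[of l] b_out[of l] by (auto simp: support_def x_def)
  qed
  ultimately have x: "x l = x i / u i * u l" for l
    using ui by (intro circuit_proportional[OF u]) simp_all
  have "x k > 0" using k(1) by (simp add: x_def)
  then have "x i \<noteq> 0" using x[of k] by force
  then have "\<not> prio i < prio k" using k(2) by (auto simp: x_def)
  moreover have "\<not> prio k < prio i" using prio_i k_supp by blast
  ultimately have "k = i" using \<open>inj prio\<close> by (metis injD linorder_neqE_nat)
  then have "?L a i = 1" "?L b i = 0" using k(1) a_le1[of i] by auto
  then have "x i = 1" by (simp add: x_def)
  then have "u j / u i = x j" using x[of j] by simp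
  also have "\<dots> \<in> \<int>" by (simp add: x_def)
  finally show "u0 j / u0 i \<in> \<int>" by (simp only: ratio)
qed

theorem unimodular_iff_integral_circuits:
  fixes A :: "nat ^ 'n ^ 'd"
  shows "unimodular TYPE('k::field) A \<longleftrightarrow> integral_circuits A"
  using unimodular_imp_integral_circuits integral_circuits_imp_unimodular by blast

section \<open>Normality from integral circuits\<close>

lemma lin_combsI:
  assumes "b = (\<Sum>j\<in>UNIV. c j *s (\<chi> i. of_nat (A $ i $ j)))" "\<And>j. c j \<in> C"
  shows "b \<in> lin_combs C A"
  unfolding lin_combs_def using assms by (intro CollectI exI[of _ c]) simp

lemma lin_comb_eq_iff:
  fixes A :: "nat ^ 'n ^ 'd" and c e :: "'n \<Rightarrow> rat"
  shows "(\<Sum>j\<in>UNIV. c j *s (\<chi> i. of_nat (A $ i $ j))) = (\<Sum>j\<in>UNIV. e j *s (\<chi> i. of_nat (A $ i $ j)))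
    \<longleftrightarrow> (\<lambda>j. c j - e j) \<in> rat_kernel A"
proof -
  have "(\<Sum>j\<in>UNIV. of_nat (A $ i $ j) * (c j - e j)) =
      (\<Sum>j\<in>UNIV. c j * of_nat (A $ i $ j)) - (\<Sum>j\<in>UNIV. e j * of_nat (A $ i $ j))" for i
    by (simp only: mult.commute[of "of_nat _"] left_diff_distrib sum_subtractf)
  then show ?thesis
    by (simp add: vec_eq_iff rat_kernel_def)
qed

text \<open>
  As long as some \<open>z k\<close> is negative, \<open>x - z\<close> is positive at \<open>k\<close>, and adding to \<open>z\<close> a conformal sign
  vector that is nonzero at \<open>k\<close> increases \<open>z k\<close>. An entry is decreased only where \<open>z\<close> exceeds
  \<open>x \<ge> 0\<close>; there \<open>z\<close> is a positive integer and stays nonnegative. So the total negative part of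
  \<open>z\<close> drops.
\<close>

lemma natural_representative:
  fixes A :: "nat ^ 'n ^ 'd" and z :: "'n \<Rightarrow> int"
  assumes "integral_circuits A" "\<And>j. x j \<ge> 0" "(\<lambda>j. x j - of_int (z j)) \<in> rat_kernel A"
  shows "\<exists>y. (\<forall>j. y j \<ge> 0) \<and> (\<lambda>j. x j - of_int (y j)) \<in> rat_kernel A"
  using assms(3)
proof (induction "\<Sum>j\<in>UNIV. nat (- z j)" arbitrary: z rule: less_induct)
  case less
  show ?case
  proof (cases "\<forall>j. z j \<ge> 0")
    case True
    then show ?thesis using less.prems by blast
  next
    case False
    then obtain k where k: "z k < 0" using not_le by blast
    have xk: "x k - of_int (z k) > 0"
    proof -
      have "of_int (z k) < (0::rat)" using k by simp
      then show ?thesis using assms(2)[of k] by linarith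
    qed
    then obtain s where s: "s \<in> rat_kernel A" "s k \<noteq> 0" "conformal s (\<lambda>j. x j - of_int (z j))"
        "\<And>j. s j \<in> {-1, 0, 1}"
      using conformal_sign_vector[OF assms(1) less.prems, of k] by force
    define z' where "z' = (\<lambda>j. z j + \<lfloor>s j\<rfloor>)"
    have fl: "of_int \<lfloor>s j\<rfloor> = s j" for j
    proof -
      have "s j \<in> \<int>" using s(4)[of j] by (auto intro: Ints_minus)
      then obtain n where "s j = of_int n" by (elim Ints_cases)
      then show ?thesis by simp
    qed
    have "(\<lambda>j. (x j - of_int (z j)) - 1 * s j) \<in> rat_kernel A"
      by (rule rat_kernel_diff[OF less.prems s(1)])
    then have ker: "(\<lambda>j. x j - of_int (z' j)) \<in> rat_kernel A"
      by (simp add: z'_def fl algebra_simps)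
    have "s k = 1"
    proof -
      have "s k * (x k - of_int (z k)) > 0" using s(2,3) unfolding conformal_def by blast
      then have "s k > 0" using xk by (auto simp: zero_less_mult_iff)
      then show ?thesis using s(4)[of k] by auto
    qed
    then have lt: "nat (- z' k) < nat (- z k)" using k by (simp add: z'_def)
    have le: "nat (- z' j) \<le> nat (- z j)" for j
    proof (cases "s j = -1")
      case True
      then have "s j \<noteq> 0" by simp
      then have "s j * (x j - of_int (z j)) > 0" using s(3) unfolding conformal_def by blast
      then have "of_int (z j) > x j" using True by simp
      then have "of_int (z j) > (0::rat)" using assms(2)[of j] by linarith
      moreover have "\<lfloor>s j\<rfloor> = -1" unfolding True by (metis floor_of_int of_int_1 of_int_minus)
      ultimately show ?thesis by (simp add: z'_def)
    next
      case False
      then show ?thesis using s(4)[of j] by (auto simp: z'_def)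
    qed
    have "(\<Sum>j\<in>UNIV. nat (- z' j)) < (\<Sum>j\<in>UNIV. nat (- z j))"
      using lt le by (intro sum_strict_mono_ex1) auto
    then show ?thesis using less.hyps ker by blast
  qed
qed

lemma integral_circuits_imp_very_ample:
  fixes A :: "nat ^ 'n ^ 'd"
  assumes "integral_circuits A"
  shows "very_ample A"
proof -
  have "lin_combs \<int> A \<inter> lin_combs {0..} A \<subseteq> lin_combs \<nat> A"
  proof
    fix b assume "b \<in> lin_combs \<int> A \<inter> lin_combs {0..} A"
    then have "b \<in> lin_combs \<int> A" "b \<in> lin_combs {0..} A" by blast+
    then obtain z x where z: "\<And>j. z j \<in> \<int>" "b = (\<Sum>j\<in>UNIV. z j *s (\<chi> i. of_nat (A $ i $ j)))"
      and x: "\<And>j. x j \<in> {0..}" "b = (\<Sum>j\<in>UNIV. x j *s (\<chi> i. of_nat (A $ i $ j)))"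
      unfolding lin_combs_def by blast
    have x0: "x j \<ge> 0" for j using x(1)[of j] by simp
    have "(\<lambda>j. x j - of_int \<lfloor>z j\<rfloor>) = (\<lambda>j. x j - z j)"
    proof
      fix j
      obtain n where "z j = of_int n" using z(1)[of j] by (elim Ints_cases)
      then show "x j - of_int \<lfloor>z j\<rfloor> = x j - z j" by simp
    qed
    moreover have "(\<lambda>j. x j - z j) \<in> rat_kernel A" using lin_comb_eq_iff[of x A z] x z by simp
    ultimately obtain y where y: "\<forall>j. y j \<ge> 0" "(\<lambda>j. x j - of_int (y j)) \<in> rat_kernel A"
      using natural_representative[where x = x, OF assms x0, where z = "\<lambda>j. \<lfloor>z j\<rfloor>"] by metis
    have "b = (\<Sum>j\<in>UNIV. of_int (y j) *s (\<chi> i. of_nat (A $ i $ j)))"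
      using lin_comb_eq_iff[of x A "\<lambda>j. of_int (y j)"] y(2) x(2) by simp
    moreover have "of_int (y j) \<in> (\<nat>::rat set)" for j
      using y(1) by (metis of_nat_in_Nats of_int_of_nat_eq zero_le_imp_eq_int)
    ultimately show "b \<in> lin_combs \<nat> A" by (rule lin_combsI)
  qed
  then show ?thesis unfolding very_ample_def by (simp add: Diff_eq_empty_iff[THEN iffD2])
qed

section \<open>Circuits and holes of Lawrence liftings\<close>

lemma sum_UNIV_Plus:
  fixes f :: "'a::finite + 'b::finite \<Rightarrow> 'c::comm_monoid_add"
  shows "(\<Sum>i\<in>UNIV. f i) = (\<Sum>i\<in>UNIV. f (Inl i)) + (\<Sum>i\<in>UNIV. f (Inr i))"
  using sum.Plus[of UNIV UNIV f] by (simp add: comp_def)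

lemma rat_kernel_lawrence:
  fixes A :: "nat ^ 'n ^ 'd"
  shows "w \<in> rat_kernel (lawrence A) \<longleftrightarrow>
     (\<lambda>j. w (Inl j)) \<in> rat_kernel A \<and> (\<forall>j. w (Inr j) = - w (Inl j))"
proof -
  have 1: "(\<Sum>j\<in>UNIV. of_nat (lawrence A $ Inl i $ j) * w j) =
      (\<Sum>j\<in>UNIV. of_nat (A $ i $ j) * w (Inl j))" for i
    by (simp add: sum_UNIV_Plus lawrence_def)
  have 2: "(\<Sum>j\<in>UNIV. of_nat (lawrence A $ Inr i $ j) * w j) = w (Inl i) + w (Inr i)" for i
  proof -
    have "of_nat (mat 1 $ i $ j) * (x::rat) = (if j = i then x else 0)" for j :: 'n and x
      by (simp add: mat_def)
    then show ?thesis by (simp add: sum_UNIV_Plus lawrence_def)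
  qed
  have "w \<in> rat_kernel (lawrence A) \<longleftrightarrow> (\<forall>i. (\<Sum>j\<in>UNIV. of_nat (lawrence A $ Inl i $ j) * w j) = 0)
      \<and> (\<forall>i. (\<Sum>j\<in>UNIV. of_nat (lawrence A $ Inr i $ j) * w j) = 0)"
    unfolding rat_kernel_def mem_Collect_eq by (rule split_sum_all)
  then show ?thesis unfolding 1 2 by (auto simp: rat_kernel_def eq_neg_iff_add_eq_0 add.commute)
qed

definition lawrence_vector :: "('n \<Rightarrow> rat) \<Rightarrow> 'n + 'n \<Rightarrow> rat" where
  "lawrence_vector u = case_sum u (\<lambda>j. - u j)"

lemma rat_kernel_lawrence_eq: "rat_kernel (lawrence A) = lawrence_vector ` rat_kernel A"
proof (intro set_eqI iffI)
  fix w assume w: "w \<in> rat_kernel (lawrence A)"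
  then have "w = lawrence_vector (\<lambda>j. w (Inl j))"
    by (auto simp: rat_kernel_lawrence lawrence_vector_def fun_eq_iff split: sum.split)
  then show "w \<in> lawrence_vector ` rat_kernel A" using w by (auto simp: rat_kernel_lawrence)
qed (auto simp: rat_kernel_lawrence lawrence_vector_def)

lemma support_lawrence_vector: "support (lawrence_vector u) = support u <+> support u"
proof (rule set_eqI)
  fix k show "k \<in> support (lawrence_vector u) \<longleftrightarrow> k \<in> support u <+> support u"
    by (cases k) (auto simp: support_def lawrence_vector_def)
qed

lemma circuit_lawrence_iff:
  fixes A :: "nat ^ 'n ^ 'd"
  shows "circuit (lawrence A) (lawrence_vector u) \<longleftrightarrow> circuit A u"
proof -
  have "support w \<subset> support u \<longleftrightarrow> support (lawrence_vector w) \<subset> support (lawrence_vector u)" for w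
    unfolding support_lawrence_vector by (auto simp: Plus_def psubset_eq)
  moreover have "lawrence_vector u \<in> rat_kernel (lawrence A) \<longleftrightarrow> u \<in> rat_kernel A"
    by (simp add: rat_kernel_lawrence lawrence_vector_def)
  moreover have "support (lawrence_vector w) = {} \<longleftrightarrow> support w = {}" for w :: "'n \<Rightarrow> rat"
    unfolding support_lawrence_vector by auto
  ultimately show ?thesis
    unfolding circuit_def by (simp add: rat_kernel_lawrence_eq)
qed

lemma integral_circuits_lawrence:
  "integral_circuits (lawrence A) \<longleftrightarrow> integral_circuits A"
proof
  assume L: "integral_circuits (lawrence A)"
  show "integral_circuits A" unfolding integral_circuits_def
  proof (intro allI impI)
    fix u i j assume u: "circuit A u" "u i \<noteq> 0"
    have "circuit (lawrence A) (lawrence_vector u)" using u(1) circuit_lawrence_iff by blast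
    moreover have "lawrence_vector u (Inl i) \<noteq> 0" using u(2) by (simp add: lawrence_vector_def)
    ultimately have "lawrence_vector u (Inl j) / lawrence_vector u (Inl i) \<in> \<int>"
      using L unfolding integral_circuits_def by blast
    then show "u j / u i \<in> \<int>" by (simp add: lawrence_vector_def)
  qed
next
  assume L: "integral_circuits A"
  show "integral_circuits (lawrence A)" unfolding integral_circuits_def
  proof (intro allI impI)
    fix w i j assume w: "circuit (lawrence A) w" "w i \<noteq> 0"
    have "w \<in> lawrence_vector ` rat_kernel A"
      using circuit_in_rat_kernel[OF w(1)] unfolding rat_kernel_lawrence_eq .
    then obtain u where u: "w = lawrence_vector u" by blast
    then have "circuit A u" using w circuit_lawrence_iff by blast
    then have "u j / u i \<in> \<int>" if "u i \<noteq> 0" for i j using L that by (auto simp: integral_circuits_def)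
    then show "w j / w i \<in> \<int>" using w(2) unfolding u
      by (auto simp: lawrence_vector_def split: sum.splits)
  qed
qed

text \<open>
  Let \<open>u\<close> be a circuit with \<open>u i = 1\<close> and \<open>u j\<close> not an integer, and let \<open>p\<close> be its entrywise
  fractional part. The point \<open>b N\<close> has the nonnegative coefficients \<open>(p, e N - p)\<close> and also the
  integral coefficients obtained by subtracting \<open>(u, -u)\<close>. In any representation with natural
  coefficients \<open>y\<close>, the two coefficients that belong to the same column of \<open>A\<close> add up to the entry
  of \<open>e N\<close>. As \<open>e N\<close> vanishes at \<open>i\<close> and outside the support of \<open>u\<close>, the difference of the first
  half of \<open>y\<close> and \<open>p\<close> is a kernel vector supported properly inside \<open>u\<close>, hence zero, although
  \<open>p j\<close> is not an integer. The summand \<open>N\<close> at \<open>j\<close> leaves this argument intact and produces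
  infinitely many such points.
\<close>

lemma very_ample_lawrence_imp_integral_circuits:
  fixes A :: "nat ^ 'n ^ 'd"
  assumes "very_ample (lawrence A)"
  shows "integral_circuits A"
  unfolding integral_circuits_def
proof (intro allI impI, rule ccontr)
  fix u0 i j assume u0: "circuit A u0" "u0 i \<noteq> 0" "u0 j / u0 i \<notin> \<int>"
  define u where "u = (\<lambda>k. (1 / u0 i) * u0 k)"
  have u: "circuit A u" "u i = 1" "u j \<notin> \<int>"
    using circuit_scale[OF u0(1), of "1 / u0 i"] u0 by (auto simp: u_def)
  define p where "p = (\<lambda>k. frac (u k))"
  \<comment> \<open>the entries at which \<open>p\<close> may be positive; \<open>p i = 0\<close> because \<open>u i = 1\<close>\<close>
  define S where "S = support u - {i}"
  define e where "e = (\<lambda>N k. (if k \<in> S then 1 else 0) + (if k = j then of_nat N else 0) :: rat)"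
  define x where "x = (\<lambda>N. case_sum p (\<lambda>k. e N k - p k))"
  define z where "z = (\<lambda>N. case_sum (\<lambda>k. p k - u k) (\<lambda>k. e N k - p k + u k))"
  define b where "b = (\<lambda>N. \<Sum>k\<in>UNIV. x N k *s (\<chi> l. of_nat (lawrence A $ l $ k)))"
  have ij: "i \<noteq> j" using u(2,3) by auto
  have p0: "k \<notin> S \<Longrightarrow> p k = 0" for k using u(2) by (auto simp: p_def S_def support_def)
  have eInts: "e N k \<in> \<int>" for N k by (auto simp: e_def)
  have frac_diff: "p k - u k \<in> \<int>" for k by (simp add: p_def frac_def)
  have xz: "(\<lambda>k. x N k - z N k) = lawrence_vector u" for N
    by (auto simp: x_def z_def lawrence_vector_def fun_eq_iff split: sum.splits)
  have "lawrence_vector u \<in> rat_kernel (lawrence A)"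
    using circuit_in_rat_kernel[OF u(1)] unfolding rat_kernel_lawrence_eq by blast
  then have bz: "b N = (\<Sum>k\<in>UNIV. z N k *s (\<chi> l. of_nat (lawrence A $ l $ k)))" for N
    unfolding b_def lin_comb_eq_iff xz .
  have zInts: "z N k \<in> \<int>" for N k
  proof (cases k)
    case (Inl l) then show ?thesis using frac_diff by (simp add: z_def)
  next
    case (Inr l)
    have "z N k = e N l - (p l - u l)" using Inr by (simp add: z_def)
    then show ?thesis using Ints_diff[OF eInts frac_diff] by metis
  qed
  have x0: "x N k \<ge> 0" for N k
  proof (cases k)
    case (Inl l) then show ?thesis by (simp add: x_def p_def)
  next
    case (Inr l)
    have "p l \<le> e N l"
    proof (cases "l \<in> S")
      case True
      then have "e N l \<ge> 1" by (simp add: e_def)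
      then show ?thesis using frac_lt_1[of "u l"] unfolding p_def by linarith
    qed (simp add: p0 e_def)
    then show ?thesis using Inr by (simp add: x_def)
  qed
  have notNat: "b N \<notin> lin_combs \<nat> (lawrence A)" for N
  proof
    assume "b N \<in> lin_combs \<nat> (lawrence A)"
    then obtain y where y: "\<And>k. y k \<in> \<nat>"
        "b N = (\<Sum>k\<in>UNIV. y k *s (\<chi> l. of_nat (lawrence A $ l $ k)))"
      by (auto simp: lin_combs_def)
    then have "(\<lambda>k. y k - x N k) \<in> rat_kernel (lawrence A)"
      using lin_comb_eq_iff[of y "lawrence A" "x N"] by (simp add: b_def)
    then have ker: "(\<lambda>k. y (Inl k) - p k) \<in> rat_kernel A"
      and sum: "\<And>k. y (Inr k) + y (Inl k) = e N k"
      by (auto simp: rat_kernel_lawrence x_def algebra_simps)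
    have y0: "y k \<ge> 0" for k using y(1)[of k] by (auto simp: Nats_def)
    have "y (Inl k) = 0" if "k \<notin> S" for k
    proof -
      have "k \<noteq> j" using that u(3) ij by (auto simp: S_def support_def)
      then have "e N k = 0" using that by (simp add: e_def)
      then show ?thesis using sum[of k] y0[of "Inl k"] y0[of "Inr k"] by linarith
    qed
    then have "y (Inl k) - p k = 0" if "k \<notin> S" for k using p0 that by simp
    then have "support (\<lambda>k. y (Inl k) - p k) \<subseteq> S" unfolding support_def by blast
    moreover have "i \<in> support u" using u(2) by (simp add: support_def)
    then have "S \<subset> support u" unfolding S_def by blast
    ultimately have "support (\<lambda>k. y (Inl k) - p k) = {}"
      using u(1) ker unfolding circuit_def by blast
    then have "j \<notin> support (\<lambda>k. y (Inl k) - p k)" by simp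
    then have "p j = y (Inl j)" by (simp add: support_def)
    then have "p j \<in> \<int>" using y(1) Nats_subset_Ints by auto
    then have "p j - (p j - u j) \<in> \<int>" using frac_diff Ints_diff by blast
    then show False using u(3) by simp
  qed
  have "b N \<in> lin_combs \<int> (lawrence A)" for N
    using bz zInts by (rule lin_combsI)
  moreover have "b N \<in> lin_combs {0..} (lawrence A)" for N
    unfolding b_def using x0 by (intro lin_combsI[OF refl]) simp
  ultimately have "b N \<in> (lin_combs \<int> (lawrence A) \<inter> lin_combs {0..} (lawrence A)) - lin_combs \<nat> (lawrence A)" for N
    using notNat by blast
  then have "finite (range b)"
    using assms unfolding very_ample_def by (meson finite_subset image_subsetI)
  moreover have "inj b"
  proof (rule injI)
    fix M N assume "b M = b N"
    then have "(\<lambda>k. x M k - x N k) \<in> rat_kernel (lawrence A)"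
      unfolding b_def lin_comb_eq_iff .
    then have "e M j = e N j" by (auto simp: rat_kernel_lawrence x_def)
    then show "M = N" by (simp add: e_def)
  qed
  ultimately show False using finite_imageD infinite_UNIV_nat by blast
qed

section \<open>The equivalence\<close>

theorem corollary5:
  fixes A :: "nat ^ 'n ^ 'd"
  assumes "configuration A"
  shows "(unimodular TYPE('k::field) A \<longleftrightarrow> unimodular TYPE('k) (lawrence A)) \<and>
         (unimodular TYPE('k) (lawrence A) \<longleftrightarrow> very_ample (lawrence A))"
  using unimodular_iff_integral_circuits integral_circuits_lawrence
    integral_circuits_imp_very_ample very_ample_lawrence_imp_integral_circuits
  by metis

end
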